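(* Let $k\ge 1$ and let $R$ be a non-nilpotent solvable Leibniz algebra of dimension $k+1$ over $\mathbb{C}$ whose nilradical is the $k$-dimensional abelian algebra $\mathcal{A}(k)$, and let $x\in R$ span a complement of $\mathcal{A}(k)$ in $R$. Assume that, in some basis of $\mathcal{A}(k)$, the operator $\mathcal{R}_x|_{\mathcal{A}(k)}:\mathcal{A}(k)\to\mathcal{A}(k)$, $y\mapsto [y,x]$, is a single $k\times k$ Jordan block $J_\lambda$. Then $R$ is isomorphic to one of the following two algebras, which are not isomorphic to each other, given in a basis $\{f_1,\dots,f_k,x\}$ by $$R_1:\quad [f_i,x]=f_i+f_{i+1}\ (1\le i\le k-1),\qquad [f_k,x]=f_k;$$ $$R_2:\quad [f_i,x]=f_i+f_{i+1}\ (1\le i\le k-1),\quad [f_k,x]=f_k,\quad [x,f_i]=-f_i-f_{i+1}\ (1\le i\le k-1),\quad [x,f_k]=-f_k,$$ where all products of basis elements not listed are zero.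
   Context: All algebras are finite-dimensional over $\mathbb{C}$. A (right) Leibniz algebra is a vector space $L$ with a bilinear bracket satisfying $[x,[y,z]]=[[x,y],z]-[[x,z],y]$ for all $x,y,z\in L$. $L$ is nilpotent if its lower central series $L^1=L$, $L^{j+1}=[L^j,L]$ reaches $0$; it is solvable if its derived series $L^{[1]}=L$, $L^{[j+1]}=[L^{[j]},L^{[j]}]$ reaches $0$. The nilradical is the maximal nilpotent ideal. $\mathcal{A}(k)$ denotes the $k$-dimensional algebra with zero bracket. *)

theory Defs
  imports
    "HOL-Library.Function_Algebras"
    "Jordan_Normal_Form.Jordan_Normal_Form"
begin

text \<open>
  The underlying space of an algebra is a subspace \<open>vectors A\<close> of an ambient complex vector space
  (the type \<^typ>\<open>'a\<close> with scalar multiplication \<open>scale A\<close>), so that ideals are again algebras over the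
  same type. The bracket is only constrained on \<open>vectors A\<close>.
\<close>

record 'a complex_algebra =
  vectors :: "'a set"
  scale :: "complex \<Rightarrow> 'a \<Rightarrow> 'a"
  bracket :: "'a \<Rightarrow> 'a \<Rightarrow> 'a"

locale leibniz_algebra = vector_space "scale A"
  for A :: "'a::ab_group_add complex_algebra" +
  assumes subspace_vectors: "subspace (vectors A)"
    and finite_dimensional: "\<exists>B. finite B \<and> span B = vectors A"
    and bracket_closed:
      "\<lbrakk>u \<in> vectors A; v \<in> vectors A\<rbrakk> \<Longrightarrow> bracket A u v \<in> vectors A"
    and bracket_add_left:
      "\<lbrakk>u \<in> vectors A; v \<in> vectors A; w \<in> vectors A\<rbrakk>
        \<Longrightarrow> bracket A (u + v) w = bracket A u w + bracket A v w"
    and bracket_add_right: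
      "\<lbrakk>u \<in> vectors A; v \<in> vectors A; w \<in> vectors A\<rbrakk>
        \<Longrightarrow> bracket A u (v + w) = bracket A u v + bracket A u w"
    and bracket_scale_left:
      "\<lbrakk>u \<in> vectors A; v \<in> vectors A\<rbrakk>
        \<Longrightarrow> bracket A (scale A c u) v = scale A c (bracket A u v)"
    and bracket_scale_right:
      "\<lbrakk>u \<in> vectors A; v \<in> vectors A\<rbrakk>
        \<Longrightarrow> bracket A u (scale A c v) = scale A c (bracket A u v)"
    and leibniz_identity:
      "\<lbrakk>u \<in> vectors A; v \<in> vectors A; w \<in> vectors A\<rbrakk>
        \<Longrightarrow> bracket A u (bracket A v w) = bracket A (bracket A u v) w - bracket A (bracket A u w) v"

definition dimension :: "'a::ab_group_add complex_algebra \<Rightarrow> nat" where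
  "dimension A = vector_space.dim (scale A) (vectors A)"

definition bracket_span ::
  "'a::ab_group_add complex_algebra \<Rightarrow> 'a set \<Rightarrow> 'a set \<Rightarrow> 'a set" where
  "bracket_span A U V = module.span (scale A) {bracket A u v | u v. u \<in> U \<and> v \<in> V}"

text \<open>Both series are indexed from \<open>0\<close>: entry \<open>j\<close> is the usual \<open>L\<^sup>j\<^sup>+\<^sup>1\<close>, resp. the \<open>(j + 1)\<close>-st derived term.\<close>

primrec lower_central :: "'a::ab_group_add complex_algebra \<Rightarrow> nat \<Rightarrow> 'a set" where
  "lower_central A 0 = vectors A"
| "lower_central A (Suc j) = bracket_span A (lower_central A j) (vectors A)"

primrec derived :: "'a::ab_group_add complex_algebra \<Rightarrow> nat \<Rightarrow> 'a set" where
  "derived A 0 = vectors A"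
| "derived A (Suc j) = bracket_span A (derived A j) (derived A j)"

definition nilpotent :: "'a::ab_group_add complex_algebra \<Rightarrow> bool" where
  "nilpotent A \<longleftrightarrow> (\<exists>j. lower_central A j = {0})"

definition solvable :: "'a::ab_group_add complex_algebra \<Rightarrow> bool" where
  "solvable A \<longleftrightarrow> (\<exists>j. derived A j = {0})"

definition abelian :: "'a::ab_group_add complex_algebra \<Rightarrow> bool" where
  "abelian A \<longleftrightarrow> (\<forall>u\<in>vectors A. \<forall>v\<in>vectors A. bracket A u v = 0)"

definition ideal_of :: "'a::ab_group_add complex_algebra \<Rightarrow> 'a set \<Rightarrow> bool" where
  "ideal_of A I \<longleftrightarrow> module.subspace (scale A) I \<and> I \<subseteq> vectors A \<and>
     (\<forall>u\<in>I. \<forall>v\<in>vectors A. bracket A u v \<in> I \<and> bracket A v u \<in> I)"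

definition subalg :: "'a complex_algebra \<Rightarrow> 'a set \<Rightarrow> 'a complex_algebra" where
  "subalg A I = A\<lparr>vectors := I\<rparr>"

definition is_nilradical :: "'a::ab_group_add complex_algebra \<Rightarrow> 'a set \<Rightarrow> bool" where
  "is_nilradical A N \<longleftrightarrow> ideal_of A N \<and> nilpotent (subalg A N) \<and>
     (\<forall>I. ideal_of A I \<and> nilpotent (subalg A I) \<longrightarrow> I \<subseteq> N)"

definition spans_complement ::
  "'a::ab_group_add complex_algebra \<Rightarrow> 'a set \<Rightarrow> 'a \<Rightarrow> bool" where
  "spans_complement A N x \<longleftrightarrow> x \<in> vectors A \<and>
     N \<inter> module.span (scale A) {x} = {0} \<and>
     {u + v | u v. u \<in> N \<and> v \<in> module.span (scale A) {x}} = vectors A"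

definition family_basis ::
  "'a::ab_group_add complex_algebra \<Rightarrow> nat \<Rightarrow> (nat \<Rightarrow> 'a) \<Rightarrow> bool" where
  "family_basis A n e \<longleftrightarrow> inj_on e {..<n} \<and>
     \<not> module.dependent (scale A) (e ` {..<n}) \<and>
     module.span (scale A) (e ` {..<n}) = vectors A"

text \<open>Column \<open>j\<close> of \<open>M\<close> holds the coordinates of \<open>T (e j)\<close>.\<close>

definition represented_by ::
  "'a::ab_group_add complex_algebra \<Rightarrow> nat \<Rightarrow> (nat \<Rightarrow> 'a) \<Rightarrow> ('a \<Rightarrow> 'a) \<Rightarrow> complex mat \<Rightarrow> bool" where
  "represented_by A n e T M \<longleftrightarrow> M \<in> carrier_mat n n \<and>
     (\<forall>j<n. T (e j) = (\<Sum>i<n. scale A (M $$ (i, j)) (e i)))"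

definition isomorphic ::
  "'a::ab_group_add complex_algebra \<Rightarrow> 'b::ab_group_add complex_algebra \<Rightarrow> bool" where
  "isomorphic A B \<longleftrightarrow> (\<exists>\<phi>. bij_betw \<phi> (vectors A) (vectors B) \<and>
     (\<forall>u\<in>vectors A. \<forall>v\<in>vectors A. \<phi> (u + v) = \<phi> u + \<phi> v) \<and>
     (\<forall>c. \<forall>u\<in>vectors A. \<phi> (scale A c u) = scale B c (\<phi> u)) \<and>
     (\<forall>u\<in>vectors A. \<forall>v\<in>vectors A. \<phi> (bracket A u v) = bracket B (\<phi> u) (\<phi> v)))"

text \<open>
  The model algebras live on the space of functions from the labels \<open>F 1, \<dots>, F k, X\<close> of the basis
  \<open>f\<^sub>1, \<dots>, f\<^sub>k, x\<close> to \<^typ>\<open>complex\<close> (extended by \<open>0\<close>); \<open>T g h\<close> is the product of the basis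
  vectors labelled \<open>g\<close> and \<open>h\<close>.
\<close>

datatype label = F nat | X

definition labels :: "nat \<Rightarrow> label set" where
  "labels k = insert X (F ` {1..k})"

definition basis_vec :: "label \<Rightarrow> label \<Rightarrow> complex" where
  "basis_vec g = (\<lambda>h. if h = g then 1 else 0)"

definition table_algebra ::
  "nat \<Rightarrow> (label \<Rightarrow> label \<Rightarrow> (label \<Rightarrow> complex)) \<Rightarrow> (label \<Rightarrow> complex) complex_algebra" where
  "table_algebra k T =
    \<lparr> vectors = {v. \<forall>g. g \<notin> labels k \<longrightarrow> v g = 0},
      scale = (\<lambda>c v m. c * v m),
      bracket = (\<lambda>u v m. \<Sum>g\<in>labels k. \<Sum>h\<in>labels k. u g * v h * T g h m) \<rparr>"

fun table1 :: "nat \<Rightarrow> label \<Rightarrow> label \<Rightarrow> (label \<Rightarrow> complex)" where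
  "table1 k (F i) X = (if i < k then basis_vec (F i) + basis_vec (F (i + 1)) else basis_vec (F i))"
| "table1 k _ _ = 0"

fun table2 :: "nat \<Rightarrow> label \<Rightarrow> label \<Rightarrow> (label \<Rightarrow> complex)" where
  "table2 k (F i) X = (if i < k then basis_vec (F i) + basis_vec (F (i + 1)) else basis_vec (F i))"
| "table2 k X (F i) = (if i < k then - basis_vec (F i) - basis_vec (F (i + 1)) else - basis_vec (F i))"
| "table2 k _ _ = 0"

definition R1 :: "nat \<Rightarrow> (label \<Rightarrow> complex) complex_algebra" where
  "R1 k = table_algebra k (table1 k)"

definition R2 :: "nat \<Rightarrow> (label \<Rightarrow> complex) complex_algebra" where
  "R2 k = table_algebra k (table2 k)"

end

theory Submission
  imports Defs
begin

text \<open>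
  Write \<open>D u = [u, x]\<close> and \<open>L u = [x, u]\<close> for the two actions of \<open>x\<close> on the abelian ideal \<open>N\<close>, and
  \<open>c = [x, x]\<close>. Since \<open>[x, [x, x]] = 0\<close>, the vector \<open>c\<close> lies in \<open>N\<close>
  (\<open>square_in_N\<close>), and hence \<open>[R, R] \<subseteq> N\<close>. As \<open>N\<close> is abelian, each further
  step of the lower central series only applies \<open>D\<close>, so a nilpotent \<open>D\<close> would make \<open>R\<close> nilpotent
  (\<open>nilpotent_if_right_nilpotent\<close>). Thus the Jordan block has an eigenvalue \<open>\<lambda> \<noteq> 0\<close>; replacing \<open>x\<close>
  by \<open>x / \<lambda>\<close> and rescaling and reversing the Jordan basis gives \<open>D f\<^sub>i = f\<^sub>i + f\<^sub>i\<^sub>+\<^sub>1\<close> with \<open>f\<^sub>k\<^sub>+\<^sub>1 = 0\<close>.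

  On \<open>N\<close> the Leibniz identity says exactly \<open>L D = D L\<close> and \<open>L (L + D) = 0\<close>, and on \<open>x\<close> it says
  \<open>L c = 0\<close>. Every nonzero vector of \<open>N\<close> is carried to a nonzero multiple of \<open>f\<^sub>k\<close> by a power of
  \<open>D - 1\<close>. Therefore an operator that commutes with \<open>D\<close> and does not kill \<open>f\<^sub>k\<close> is injective
  (\<open>commuting_injective\<close>). This decides everything:

  \<^item> If \<open>L f\<^sub>k \<noteq> 0\<close>, then \<open>L\<close> is injective, so \<open>L = - D\<close> and \<open>c = 0\<close>, which is the table of \<open>R\<^sub>2\<close>.
  \<^item> If \<open>L f\<^sub>k = 0\<close>, then \<open>L + D\<close> fixes \<open>f\<^sub>k\<close>, hence is injective, so \<open>L = 0\<close>. As \<open>D\<close> is onto \<open>N\<close>,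
    there is \<open>m\<close> with \<open>D m = c\<close>, and \<open>x - m\<close> has square \<open>0\<close> while acting as \<open>x\<close> does.
    This is the table of \<open>R\<^sub>1\<close>.

  The two models differ because \<open>[v, v] = 0\<close> holds identically in \<open>R\<^sub>2\<close> but not in \<open>R\<^sub>1\<close>.
\<close>

section \<open>Recognising a table algebra\<close>

definition linear_combination ::
  "'a::ab_group_add complex_algebra \<Rightarrow> nat \<Rightarrow> (label \<Rightarrow> 'a) \<Rightarrow> (label \<Rightarrow> complex) \<Rightarrow> 'a" where
  "linear_combination A k b v = (\<Sum>g\<in>labels k. scale A (v g) (b g))"

lemma finite_labels [simp]: "finite (labels k)"
  by (simp add: labels_def)

text \<open>
  The closure hypotheses on \<open>A\<close> are what lets the inverse bijection be compared with \<open>\<phi>\<close>: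
  both sides of each homomorphism equation must lie in \<open>vectors A\<close>, where \<open>\<phi>\<close> is injective.
\<close>

lemma isomorphic_sym:
  assumes iso: "isomorphic A B"
    and add: "\<And>u v. \<lbrakk>u \<in> vectors A; v \<in> vectors A\<rbrakk> \<Longrightarrow> u + v \<in> vectors A"
    and scale: "\<And>c u. u \<in> vectors A \<Longrightarrow> scale A c u \<in> vectors A"
    and bracket: "\<And>u v. \<lbrakk>u \<in> vectors A; v \<in> vectors A\<rbrakk> \<Longrightarrow> bracket A u v \<in> vectors A"
  shows "isomorphic B A"
proof -
  from iso obtain \<phi> where bij: "bij_betw \<phi> (vectors A) (vectors B)"
    and hom_add: "\<And>u v. \<lbrakk>u \<in> vectors A; v \<in> vectors A\<rbrakk> \<Longrightarrow> \<phi> (u + v) = \<phi> u + \<phi> v"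
    and hom_scale: "\<And>c u. u \<in> vectors A \<Longrightarrow> \<phi> (scale A c u) = scale B c (\<phi> u)"
    and hom_bracket: "\<And>u v. \<lbrakk>u \<in> vectors A; v \<in> vectors A\<rbrakk>
          \<Longrightarrow> \<phi> (bracket A u v) = bracket B (\<phi> u) (\<phi> v)"
    unfolding isomorphic_def by blast
  define \<psi> where "\<psi> = the_inv_into (vectors A) \<phi>"
  have inj: "inj_on \<phi> (vectors A)" and img: "\<phi> ` vectors A = vectors B"
    using bij by (auto simp: bij_betw_def)
  have bij': "bij_betw \<psi> (vectors B) (vectors A)"
    unfolding \<psi>_def by (rule bij_betw_the_inv_into[OF bij])
  have into: "\<psi> u \<in> vectors A" if "u \<in> vectors B" for u
    using bij' that by (auto simp: bij_betw_def)
  have right: "\<phi> (\<psi> u) = u" if "u \<in> vectors B" for u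
    unfolding \<psi>_def using f_the_inv_into_f[OF inj] img that by blast
  have left: "\<psi> (\<phi> u) = u" if "u \<in> vectors A" for u
    unfolding \<psi>_def using the_inv_into_f_f[OF inj that] .
  have "\<psi> (u + v) = \<psi> u + \<psi> v" if "u \<in> vectors B" "v \<in> vectors B" for u v
    using left[of "\<psi> u + \<psi> v"] hom_add add into right that by simp
  moreover have "\<psi> (scale B c u) = scale A c (\<psi> u)" if "u \<in> vectors B" for c u
    using left[of "scale A c (\<psi> u)"] hom_scale scale into right that by simp
  moreover have "\<psi> (bracket B u v) = bracket A (\<psi> u) (\<psi> v)"
    if "u \<in> vectors B" "v \<in> vectors B" for u v
    using left[of "bracket A (\<psi> u) (\<psi> v)"] hom_bracket bracket into right that by simp
  ultimately show ?thesis
    unfolding isomorphic_def using bij' by blast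
qed

context leibniz_algebra
begin

lemma zero_vectors [simp]: "0 \<in> vectors A"
  by (rule subspace_0[OF subspace_vectors])

lemma scale_vectors [simp]: "u \<in> vectors A \<Longrightarrow> scale A c u \<in> vectors A"
  by (rule subspace_scale[OF subspace_vectors])

lemma add_vectors [simp]: "\<lbrakk>u \<in> vectors A; v \<in> vectors A\<rbrakk> \<Longrightarrow> u + v \<in> vectors A"
  by (rule subspace_add[OF subspace_vectors])

lemma bracket_zero_left [simp]: "v \<in> vectors A \<Longrightarrow> bracket A 0 v = 0"
  using bracket_scale_left[of 0 v 0] by simp

lemma bracket_zero_right [simp]: "v \<in> vectors A \<Longrightarrow> bracket A v 0 = 0"
  using bracket_scale_right[of v 0 0] by simp

lemma bracket_sum_left:
  assumes "finite I" "\<And>i. i \<in> I \<Longrightarrow> u i \<in> vectors A" "w \<in> vectors A"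
  shows "bracket A (\<Sum>i\<in>I. scale A (c i) (u i)) w = (\<Sum>i\<in>I. scale A (c i) (bracket A (u i) w))"
  using assms
  by (induction I rule: finite_induct)
     (simp_all add: bracket_add_left bracket_scale_left subspace_sum[OF subspace_vectors])

lemma bracket_sum_right:
  assumes "finite I" "\<And>i. i \<in> I \<Longrightarrow> u i \<in> vectors A" "w \<in> vectors A"
  shows "bracket A w (\<Sum>i\<in>I. scale A (c i) (u i)) = (\<Sum>i\<in>I. scale A (c i) (bracket A w (u i)))"
  using assms
  by (induction I rule: finite_induct)
     (simp_all add: bracket_add_right bracket_scale_right subspace_sum[OF subspace_vectors])

lemma linear_combination_add:
  "linear_combination A k b (v + w) = linear_combination A k b v + linear_combination A k b w"
  by (simp add: linear_combination_def scale_left_distrib sum.distrib)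

lemma linear_combination_minus:
  "linear_combination A k b (- v) = - linear_combination A k b v"
  by (simp add: linear_combination_def sum_negf)

lemma linear_combination_diff:
  "linear_combination A k b (v - w) = linear_combination A k b v - linear_combination A k b w"
  by (simp add: linear_combination_def scale_left_diff_distrib sum_subtractf)

lemma linear_combination_zero [simp]: "linear_combination A k b 0 = 0"
  by (simp add: linear_combination_def)

lemma linear_combination_basis_vec:
  assumes "g \<in> labels k"
  shows "linear_combination A k b (basis_vec g) = b g"
proof -
  have "linear_combination A k b (basis_vec g) = (\<Sum>h\<in>labels k. if h = g then b h else 0)"
    unfolding linear_combination_def basis_vec_def by (intro sum.cong) auto
  then show ?thesis using assms by simp
qed

text \<open>
  The isomorphism is the coordinate map of the basis \<open>b\<close>. It is easiest to
  check its inverse \<open>linear_combination A k b\<close>, which is multiplicative by bilinearity.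
\<close>

lemma isomorphic_table_algebra:
  assumes inj: "inj_on b (labels k)"
    and indep: "independent (b ` labels k)"
    and span: "span (b ` labels k) = vectors A"
    and support: "\<And>g h m. \<lbrakk>g \<in> labels k; h \<in> labels k; m \<notin> labels k\<rbrakk> \<Longrightarrow> T g h m = 0"
    and table: "\<And>g h. \<lbrakk>g \<in> labels k; h \<in> labels k\<rbrakk>
          \<Longrightarrow> bracket A (b g) (b h) = linear_combination A k b (T g h)"
  shows "isomorphic A (table_algebra k T)"
proof (rule isomorphic_sym)
  let ?B = "table_algebra k T"
  let ?\<psi> = "linear_combination A k b"
  have b: "b g \<in> vectors A" if "g \<in> labels k" for g
    using span span_base that by blast
  have "inj_on ?\<psi> (vectors ?B)"
  proof (rule inj_onI)
    fix v w assume v: "v \<in> vectors ?B" and w: "w \<in> vectors ?B" and eq: "?\<psi> v = ?\<psi> w"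
    define c where "c = (\<lambda>y. (v - w) (the_inv_into (labels k) b y))"
    have "?\<psi> (v - w) = 0"
      using eq linear_combination_add[of k b "v - w" w] by simp
    moreover have "?\<psi> (v - w) = (\<Sum>y\<in>b ` labels k. scale A (c y) y)"
      unfolding linear_combination_def c_def
      by (simp add: sum.reindex[OF inj] the_inv_into_f_f[OF inj])
    ultimately have "c y = 0" if "y \<in> b ` labels k" for y
      using independentD[OF indep _ subset_refl, of c] that by auto
    then have "(v - w) g = 0" if "g \<in> labels k" for g
      using that the_inv_into_f_f[OF inj that] unfolding c_def by force
    then show "v = w"
      using v w by (auto simp: fun_eq_iff table_algebra_def) (metis)
  qed
  moreover have "?\<psi> ` vectors ?B = vectors A"
  proof
    show "?\<psi> ` vectors ?B \<subseteq> vectors A"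
      using b by (auto simp: linear_combination_def intro!: subspace_sum[OF subspace_vectors])
    show "vectors A \<subseteq> ?\<psi> ` vectors ?B"
    proof
      fix u assume "u \<in> vectors A"
      then obtain c where "u = (\<Sum>y\<in>b ` labels k. scale A (c y) y)"
        using span span_finite[of "b ` labels k"] by auto
      then have "u = ?\<psi> (\<lambda>g. if g \<in> labels k then c (b g) else 0)"
        unfolding linear_combination_def by (simp add: sum.reindex[OF inj])
      then show "u \<in> ?\<psi> ` vectors ?B"
        by (auto simp: table_algebra_def)
    qed
  qed
  ultimately have bij: "bij_betw ?\<psi> (vectors ?B) (vectors A)"
    by (simp add: bij_betw_def)
  have scale: "?\<psi> (scale ?B c v) = scale A c (?\<psi> v)" for c v
    by (simp add: linear_combination_def table_algebra_def scale_sum_right)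
  have bracket: "?\<psi> (bracket ?B v w) = bracket A (?\<psi> v) (?\<psi> w)" for v w
  proof -
    have "bracket A (?\<psi> v) (?\<psi> w) =
        (\<Sum>g\<in>labels k. scale A (v g) (\<Sum>h\<in>labels k. scale A (w h) (bracket A (b g) (b h))))"
      unfolding linear_combination_def
      using b by (subst bracket_sum_left)
        (auto simp: bracket_sum_right intro!: subspace_sum[OF subspace_vectors])
    also have "\<dots> = (\<Sum>g\<in>labels k. \<Sum>h\<in>labels k. \<Sum>m\<in>labels k.
        scale A (v g * w h * T g h m) (b m))"
      by (simp add: table linear_combination_def scale_sum_right mult.assoc)
    also have "\<dots> = (\<Sum>g\<in>labels k. \<Sum>m\<in>labels k. \<Sum>h\<in>labels k.
        scale A (v g * w h * T g h m) (b m))"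
      by (intro sum.cong refl sum.swap)
    also have "\<dots> = (\<Sum>m\<in>labels k. \<Sum>g\<in>labels k. \<Sum>h\<in>labels k.
        scale A (v g * w h * T g h m) (b m))"
      by (rule sum.swap)
    also have "\<dots> = ?\<psi> (bracket ?B v w)"
      by (simp add: linear_combination_def table_algebra_def scale_sum_left)
    finally show ?thesis by simp
  qed
  show "isomorphic ?B A"
    unfolding isomorphic_def
    using bij linear_combination_add scale bracket by blast
next
  fix c u v
  assume "u \<in> vectors (table_algebra k T)"
  then show "scale (table_algebra k T) c u \<in> vectors (table_algebra k T)"
    by (simp add: table_algebra_def)
next
  fix u v
  assume uv: "u \<in> vectors (table_algebra k T)" "v \<in> vectors (table_algebra k T)"
  then show "u + v \<in> vectors (table_algebra k T)"
    by (simp add: table_algebra_def)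
  show "bracket (table_algebra k T) u v \<in> vectors (table_algebra k T)"
    by (simp add: table_algebra_def support)
qed

end

section \<open>Endomorphisms of a subspace\<close>

context leibniz_algebra
begin

definition endomorphism_on :: "'a set \<Rightarrow> ('a \<Rightarrow> 'a) \<Rightarrow> bool" where
  "endomorphism_on N T \<longleftrightarrow> (\<forall>u\<in>N. T u \<in> N) \<and> (\<forall>u\<in>N. \<forall>v\<in>N. T (u + v) = T u + T v) \<and>
     (\<forall>c. \<forall>u\<in>N. T (scale A c u) = scale A c (T u))"

lemma endomorphism_on_sum:
  assumes N: "subspace N" and T: "endomorphism_on N T"
    and "finite I" "\<And>i. i \<in> I \<Longrightarrow> u i \<in> N"
  shows "T (\<Sum>i\<in>I. scale A (c i) (u i)) = (\<Sum>i\<in>I. scale A (c i) (T (u i)))"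
proof -
  have "T 0 = 0"
    using T subspace_0[OF N] unfolding endomorphism_on_def
    by (metis scale_zero_left)
  with assms(3,4) show ?thesis
    using T by (induction I rule: finite_induct)
       (simp_all add: endomorphism_on_def subspace_sum[OF N] subspace_scale[OF N])
qed

lemma endomorphism_on_zero:
  assumes "subspace N" "endomorphism_on N T"
  shows "T 0 = 0"
  using endomorphism_on_sum[OF assms, of "{}"] by simp

lemma endomorphism_on_funpow:
  assumes "endomorphism_on N T"
  shows "endomorphism_on N (T ^^ n)"
  using assms by (induction n) (simp_all add: endomorphism_on_def)

lemma subspace_image_endomorphism_on:
  assumes N: "subspace N" and T: "endomorphism_on N T"
  shows "subspace (T ` N)"
proof (rule subspaceI)
  show "0 \<in> T ` N"
    using endomorphism_on_zero[OF N T] subspace_0[OF N] by force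
next
  fix u v assume "u \<in> T ` N" "v \<in> T ` N"
  then show "u + v \<in> T ` N"
    using T subspace_add[OF N] unfolding endomorphism_on_def by (auto) (metis image_eqI)
next
  fix c u assume "u \<in> T ` N"
  then show "scale A c u \<in> T ` N"
    using T subspace_scale[OF N] unfolding endomorphism_on_def by (auto) (metis image_eqI)
qed


text \<open>A basis contained in \<open>W\<close> already has \<open>dim V\<close> elements, so it exhausts \<open>W\<close>.\<close>

lemma spanning_independent_if_card_le_dim:
  assumes "finite W" "span W = V" "card W \<le> dim V"
  shows "independent W"
proof -
  obtain B where B: "B \<subseteq> W" "independent B" "W \<subseteq> span B"
    using maximal_independent_subset[of W] by blast
  have "span B = V"
    using B assms(2) span_mono[of B W] span_mono[of W "span B"] by (auto simp: span_span)
  then have "card B = dim V"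
    using B(2) dim_span_eq_card_independent by metis
  then have "B = W"
    using assms(1,3) B(1) by (metis card_seteq)
  then show ?thesis using B(2) by simp
qed

end

section \<open>One-dimensional extensions of an abelian ideal\<close>

locale abelian_extension = leibniz_algebra A
  for A :: "'a::ab_group_add complex_algebra" +
  fixes N :: "'a set" and x :: 'a
  assumes ideal: "ideal_of A N"
    and abelian: "\<lbrakk>u \<in> N; v \<in> N\<rbrakk> \<Longrightarrow> bracket A u v = 0"
    and x_vectors [simp]: "x \<in> vectors A"
    and x_notin: "x \<notin> N"
    and decompose: "u \<in> vectors A \<Longrightarrow> \<exists>n\<in>N. \<exists>c. u = n + scale A c x"
begin

lemma subspace_N: "subspace N"
  using ideal by (simp add: ideal_of_def)

lemma N_vectors [simp]: "u \<in> N \<Longrightarrow> u \<in> vectors A"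
  using ideal by (auto simp: ideal_of_def)

lemmas N_add [simp] = subspace_add[OF subspace_N]
  and N_diff [simp] = subspace_diff[OF subspace_N]
  and N_neg [simp] = subspace_neg[OF subspace_N]
  and N_scale [simp] = subspace_scale[OF subspace_N]
  and N_zero [simp] = subspace_0[OF subspace_N]

lemma bracket_N_left [simp]: "\<lbrakk>u \<in> N; v \<in> vectors A\<rbrakk> \<Longrightarrow> bracket A u v \<in> N"
  using ideal by (simp add: ideal_of_def)

lemma bracket_N_right [simp]: "\<lbrakk>u \<in> N; v \<in> vectors A\<rbrakk> \<Longrightarrow> bracket A v u \<in> N"
  using ideal by (simp add: ideal_of_def)

lemma bracket_minus_right: "\<lbrakk>u \<in> vectors A; v \<in> vectors A\<rbrakk> \<Longrightarrow> bracket A u (- v) = - bracket A u v"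
  using bracket_scale_right[of u v "-1"] by simp

lemma bracket_minus_left: "\<lbrakk>u \<in> vectors A; v \<in> vectors A\<rbrakk> \<Longrightarrow> bracket A (- u) v = - bracket A u v"
  using bracket_scale_left[of u v "-1"] by simp

lemma scale_x_in_N_iff: "scale A c x \<in> N \<longleftrightarrow> c = 0"
proof
  assume "scale A c x \<in> N"
  then have "scale A (inverse c) (scale A c x) \<in> N" by (rule N_scale)
  then show "c = 0" using x_notin by (cases "c = 0") auto
qed simp

text \<open>
  All hypotheses are insensitive to the choice of the complement vector; this allows both the
  normalisation of the eigenvalue and the removal of \<open>[x, x]\<close>.
\<close>

lemma change_generator:
  assumes c: "c \<noteq> 0" and n: "n \<in> N"
  shows "abelian_extension A N (scale A c x + n)"
proof
  show "scale A c x + n \<notin> N"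
  proof
    assume "scale A c x + n \<in> N"
    then have "scale A c x + n - n \<in> N" using n by (rule N_diff)
    then show False using c by (simp add: scale_x_in_N_iff)
  qed
  fix u assume "u \<in> vectors A"
  then obtain m d where m: "m \<in> N" and u: "u = m + scale A d x"
    using decompose by blast
  have "u = (m - scale A (d / c) n) + scale A (d / c) (scale A c x + n)"
    using c by (simp add: u scale_right_distrib)
  then show "\<exists>m\<in>N. \<exists>d. u = m + scale A d (scale A c x + n)"
    using N_diff[OF m N_scale[OF n]] by blast
qed (use ideal abelian n in auto)

text \<open>
  If \<open>[x, x] = n + c x\<close>, then \<open>0 = [x, [x, x]] = [x, n] + c [x, x]\<close>; its component along \<open>x\<close> is
  \<open>c\<^sup>2\<close>.
\<close>

lemma square_in_N: "bracket A x x \<in> N"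
proof -
  obtain n c where n: "n \<in> N" and sq: "bracket A x x = n + scale A c x"
    using decompose[of "bracket A x x"] bracket_closed by auto
  have "bracket A x (bracket A x x) = 0"
    using leibniz_identity[of x x x] by simp
  then have "scale A c (bracket A x x) = - bracket A x n"
    using n by (simp add: sq bracket_add_right bracket_scale_right add_eq_0_iff)
  also have "\<dots> \<in> N" using n by simp
  finally have "scale A c n + scale A (c * c) x \<in> N"
    by (simp add: sq scale_right_distrib)
  then have "scale A c n + scale A (c * c) x - scale A c n \<in> N"
    by (rule N_diff) (simp add: n)
  then have "c = 0" by (simp add: scale_x_in_N_iff)
  then show ?thesis using n by (simp add: sq)
qed

lemma bracket_in_N:
  assumes "u \<in> vectors A" "v \<in> vectors A"
  shows "bracket A u v \<in> N"
proof -
  obtain n c where n: "n \<in> N" "u = n + scale A c x" using decompose assms(1) by blast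
  obtain m d where m: "m \<in> N" "v = m + scale A d x" using decompose assms(2) by blast
  show ?thesis
    using n m square_in_N
    by (simp add: bracket_add_left bracket_add_right bracket_scale_left bracket_scale_right)
qed

lemma left_square: "bracket A x (bracket A x x) = 0"
  using leibniz_identity[of x x x] by simp

text \<open>
  The next two lemmas are the Leibniz identity for \<open>(x, u, x)\<close> and \<open>(x, x, u)\<close>. In both, the term
  with \<open>[[x, x], u]\<close> vanishes because \<open>[x, x]\<close> lies in the abelian ideal.
\<close>

lemma left_right_commute:
  assumes "u \<in> N"
  shows "bracket A x (bracket A u x) = bracket A (bracket A x u) x"
  using leibniz_identity[of x u x] assms square_in_N abelian by simp

lemma left_left:
  assumes "u \<in> N"
  shows "bracket A x (bracket A x u) = - bracket A (bracket A x u) x"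
  using leibniz_identity[of x x u] assms square_in_N abelian by simp

lemma endomorphism_right: "endomorphism_on N (\<lambda>u. bracket A u x)"
  by (simp add: endomorphism_on_def bracket_add_left bracket_scale_left)

lemma endomorphism_left: "endomorphism_on N (\<lambda>u. bracket A x u)"
  by (simp add: endomorphism_on_def bracket_add_right bracket_scale_right)

text \<open>
  The first bracket lands in \<open>N\<close>; after that the \<open>N\<close>-component of the right factor acts by zero,
  so each step multiplies by \<open>x\<close> from the right.
\<close>

lemma lower_central_subset:
  "lower_central A (Suc j) \<subseteq> ((\<lambda>u. bracket A u x) ^^ j) ` N"
proof (induction j)
  case 0
  show ?case
    using span_minimal[OF _ subspace_N, of "{bracket A u v |u v. u \<in> vectors A \<and> v \<in> vectors A}"]
      bracket_in_N by (auto simp: bracket_span_def)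
next
  case (Suc j)
  let ?D = "\<lambda>u. bracket A u x"
  have into: "endomorphism_on N (?D ^^ j)" for j
    by (rule endomorphism_on_funpow[OF endomorphism_right])
  have sub: "subspace ((?D ^^ Suc j) ` N)"
    by (rule subspace_image_endomorphism_on[OF subspace_N into])
  have "bracket A u v \<in> (?D ^^ Suc j) ` N"
    if u: "u \<in> lower_central A (Suc j)" and v: "v \<in> vectors A" for u v
  proof -
    obtain w where w: "w \<in> N" "u = (?D ^^ j) w" using u Suc by blast
    have uN: "u \<in> N" using w into[of j] by (simp add: endomorphism_on_def)
    obtain n c where n: "n \<in> N" and vn: "v = n + scale A c x" using decompose v by blast
    have "bracket A u v = scale A c ((?D ^^ Suc j) w)"
      using uN n w by (simp add: vn bracket_add_right bracket_scale_right abelian)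
    moreover have "(?D ^^ Suc j) w \<in> (?D ^^ Suc j) ` N" using w(1) by (rule imageI)
    ultimately show ?thesis using subspace_scale[OF sub] by metis
  qed
  then show ?case
    unfolding lower_central.simps(2)[of A "Suc j"] bracket_span_def
    by (intro span_minimal sub) blast
qed

lemma nilpotent_if_right_nilpotent:
  assumes "\<And>u. u \<in> N \<Longrightarrow> ((\<lambda>u. bracket A u x) ^^ j) u = 0"
  shows "nilpotent A"
proof -
  have "lower_central A (Suc j) \<subseteq> {0}"
    using lower_central_subset[of j] assms by auto
  moreover have "0 \<in> lower_central A (Suc j)"
    by (simp add: bracket_span_def span_zero)
  ultimately show ?thesis
    unfolding nilpotent_def by (intro exI[of _ "Suc j"]) blast
qed

end

section \<open>The single Jordan block with eigenvalue one\<close>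

text \<open>
  The values \<open>f i = 0\<close> for \<open>i > k\<close> make the chain relation uniform in \<open>i\<close>. Independence
  of the \<open>f i\<close> and \<open>x\<close> is forced by the dimension of \<open>A\<close>.
\<close>

locale jordan_extension = abelian_extension +
  fixes k :: nat and f :: "nat \<Rightarrow> 'a"
  assumes k_pos: "1 \<le> k"
    and dim_A: "dimension A = Suc k"
    and span_f: "span (f ` {1..k}) = N"
    and chain: "1 \<le> i \<Longrightarrow> bracket A (f i) x = f i + f (Suc i)"
    and beyond: "k < i \<Longrightarrow> f i = 0"
begin

abbreviation b :: "label \<Rightarrow> 'a" where
  "b \<equiv> case_label f x"

lemma f_N [simp]: "1 \<le> i \<Longrightarrow> f i \<in> N"
  using span_base[of "f i" "f ` {1..k}"] span_f beyond[of i]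
  by (cases "i \<le> k") auto

lemma span_b: "span (b ` labels k) = vectors A"
proof
  have b_labels: "b ` labels k = insert x (f ` {1..k})"
    by (simp add: labels_def image_image)
  show "span (b ` labels k) \<subseteq> vectors A"
    unfolding b_labels by (intro span_minimal subspace_vectors) auto
  show "vectors A \<subseteq> span (b ` labels k)"
  proof
    fix u assume "u \<in> vectors A"
    then obtain n c where n: "n \<in> N" "u = n + scale A c x" using decompose by blast
    have "n \<in> span (b ` labels k)"
      using n(1) span_f span_mono[of "f ` {1..k}" "b ` labels k"] b_labels by blast
    moreover have "x \<in> span (b ` labels k)"
      by (rule span_base) (simp add: b_labels)
    ultimately show "u \<in> span (b ` labels k)"
      by (simp add: n(2) span_add span_scale)
  qed
qed

lemma card_labels: "card (labels k) = Suc k"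
proof -
  have "card (F ` {1..k}) = k" by (subst card_image) (auto simp: inj_on_def)
  moreover have "X \<notin> F ` {1..k}" by auto
  ultimately show ?thesis by (simp add: labels_def)
qed

lemma independent_b: "independent (b ` labels k)"
proof (rule spanning_independent_if_card_le_dim[OF _ span_b])
  show "card (b ` labels k) \<le> dim (vectors A)"
    using card_image_le[OF finite_labels[of k], of b] dim_A by (simp add: card_labels dimension_def)
qed simp

lemma inj_b: "inj_on b (labels k)"
proof (rule eq_card_imp_inj_on)
  have "Suc k \<le> card (b ` labels k)"
    using dim_le_card[of "vectors A" "b ` labels k"] span_b dim_A by (simp add: dimension_def)
  then show "card (b ` labels k) = card (labels k)"
    using card_image_le[OF finite_labels[of k], of b] by (simp add: card_labels)
qed simp

lemma f_k_nonzero: "f k \<noteq> 0"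
proof
  assume "f k = 0"
  moreover have "F k \<in> labels k" using k_pos by (simp add: labels_def)
  ultimately have "0 \<in> b ` labels k" by force
  then show False using independent_b dependent_zero by blast
qed

lemma inj_f: "inj_on f {1..k}"
proof (rule inj_onI)
  fix i j assume "i \<in> {1..k}" "j \<in> {1..k}" "f i = f j"
  then show "i = j"
    using inj_onD[OF inj_b, of "F i" "F j"] by (simp add: labels_def)
qed

abbreviation shift :: "'a \<Rightarrow> 'a" where
  "shift u \<equiv> bracket A u x - u"

lemma endomorphism_shift: "endomorphism_on N (\<lambda>u. shift u)"
  by (simp add: endomorphism_on_def bracket_add_left bracket_scale_left scale_right_diff_distrib)

lemma shift_funpow: "1 \<le> i \<Longrightarrow> ((\<lambda>u. shift u) ^^ j) (f i) = f (i + j)"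
  by (induction j) (simp_all add: chain)

text \<open>
  If \<open>i\<close> is the least index with a nonzero coefficient in \<open>u\<close>, then \<open>k - i\<close> shifts move that term to
  \<open>f k\<close> and all later terms beyond the end of the chain.
\<close>

lemma shift_reaches_socle:
  assumes "u \<in> N" "u \<noteq> 0"
  obtains j c where "c \<noteq> 0" "((\<lambda>u. shift u) ^^ j) u = scale A c (f k)"
proof -
  obtain a where "u = (\<Sum>v\<in>f ` {1..k}. scale A (a v) v)"
    using assms(1) span_f span_finite[of "f ` {1..k}"] by auto
  then have u: "u = (\<Sum>i\<in>{1..k}. scale A (a (f i)) (f i))"
    unfolding sum.reindex[OF inj_f] by simp
  define i where "i = (LEAST i. i \<in> {1..k} \<and> a (f i) \<noteq> 0)"
  have "\<exists>i. i \<in> {1..k} \<and> a (f i) \<noteq> 0"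
  proof (rule ccontr)
    assume "\<not> ?thesis"
    then have "u = 0" unfolding u by (intro sum.neutral) auto
    with assms(2) show False by simp
  qed
  then have i: "i \<in> {1..k}" "a (f i) \<noteq> 0"
    using LeastI_ex[of "\<lambda>i. i \<in> {1..k} \<and> a (f i) \<noteq> 0"] unfolding i_def by blast+
  have least: "a (f j) = 0" if "j \<in> {1..k}" "j < i" for j
    using not_less_Least[of j] that unfolding i_def by blast
  have "((\<lambda>u. shift u) ^^ (k - i)) u = (\<Sum>j\<in>{1..k}. scale A (a (f j)) (f (j + (k - i))))"
    unfolding u
    by (subst endomorphism_on_sum[OF subspace_N endomorphism_on_funpow[OF endomorphism_shift]])
       (auto simp: shift_funpow)
  also have "\<dots> = (\<Sum>j\<in>{1..k}. if j = i then scale A (a (f i)) (f k) else 0)"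
  proof (rule sum.cong[OF refl])
    fix j assume j: "j \<in> {1..k}"
    consider "j < i" | "j = i" | "j > i" by linarith
    then show "scale A (a (f j)) (f (j + (k - i))) = (if j = i then scale A (a (f i)) (f k) else 0)"
      using i j least beyond[of "j + (k - i)"] by cases auto
  qed
  also have "\<dots> = scale A (a (f i)) (f k)" using i by simp
  finally show ?thesis using i(2) that by blast
qed

text \<open>
  The kernel of \<open>T\<close> is stable under the shift, so if it were nonzero it would contain \<open>f k\<close>
  by the previous lemma.
\<close>

lemma commuting_injective:
  assumes T: "endomorphism_on N T"
    and comm: "\<And>u. u \<in> N \<Longrightarrow> T (bracket A u x) = bracket A (T u) x"
    and socle: "T (f k) \<noteq> 0"
    and u: "u \<in> N" "T u = 0"
  shows "u = 0"
proof (rule ccontr)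
  assume "u \<noteq> 0"
  then obtain j c where c: "c \<noteq> 0" and reach: "((\<lambda>u. shift u) ^^ j) u = scale A c (f k)"
    using shift_reaches_socle u(1) by blast
  have T_diff: "T (v - w) = T v - T w" if "v \<in> N" "w \<in> N" for v w
    using T N_diff[OF that] that unfolding endomorphism_on_def
    by (metis diff_add_cancel add_diff_cancel_right')
  have "((\<lambda>u. shift u) ^^ j) u \<in> N \<and> T (((\<lambda>u. shift u) ^^ j) u) = 0"
    using u by (induction j) (simp_all add: T_diff comm)
  then have "scale A c (T (f k)) = 0"
    using T k_pos by (simp add: reach endomorphism_on_def)
  then show False using c socle by simp
qed

text \<open>
  From \<open>f i = D (f i) - f (i + 1)\<close>, the image of \<open>D\<close> contains the chain by descending induction from
  \<open>f (k + 1) = 0\<close>.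
\<close>

lemma right_surjective:
  assumes "u \<in> N"
  shows "\<exists>v\<in>N. bracket A v x = u"
proof -
  let ?I = "(\<lambda>v. bracket A v x) ` N"
  have sub: "subspace ?I"
    by (rule subspace_image_endomorphism_on[OF subspace_N endomorphism_right])
  have "f i \<in> ?I" if "1 \<le> i" "i \<le> Suc k" for i
    using that(2,1)
  proof (induction i rule: inc_induct)
    case base
    then show ?case using beyond[of "Suc k"] subspace_0[OF sub] by simp
  next
    case (step i)
    have "bracket A (f i) x \<in> ?I" using step.prems by (intro imageI) simp
    then have "bracket A (f i) x - f (Suc i) \<in> ?I"
      using step by (intro subspace_diff[OF sub]) simp_all
    then show ?case using step.prems by (simp add: chain)
  qed
  then have "span (f ` {1..k}) \<subseteq> ?I"
    by (intro span_minimal sub) auto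
  then show ?thesis using assms span_f by blast
qed

lemma linear_combination_F [simp]:
  "i \<in> {1..k} \<Longrightarrow> linear_combination A k b (basis_vec (F i)) = f i"
  by (subst linear_combination_basis_vec) (auto simp: labels_def)

lemma isomorphic_R1_if:
  assumes "bracket A x x = 0" "\<And>u. u \<in> N \<Longrightarrow> bracket A x u = 0"
  shows "isomorphic A (R1 k)"
  unfolding R1_def
proof (rule isomorphic_table_algebra[OF inj_b independent_b span_b])
  show "table1 k g h m = 0" if "g \<in> labels k" "h \<in> labels k" "m \<notin> labels k" for g h m
    using that by (cases g; cases h) (auto simp: labels_def basis_vec_def)
  show "bracket A (b g) (b h) = linear_combination A k b (table1 k g h)"
    if "g \<in> labels k" "h \<in> labels k" for g h
    using that assms beyond[of "Suc k"]
    by (cases g; cases h)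
       (auto simp: labels_def abelian chain linear_combination_add not_less)
qed

lemma isomorphic_R2_if:
  assumes "bracket A x x = 0" "\<And>u. u \<in> N \<Longrightarrow> bracket A x u = - bracket A u x"
  shows "isomorphic A (R2 k)"
  unfolding R2_def
proof (rule isomorphic_table_algebra[OF inj_b independent_b span_b])
  show "table2 k g h m = 0" if "g \<in> labels k" "h \<in> labels k" "m \<notin> labels k" for g h m
    using that by (cases g; cases h) (auto simp: labels_def basis_vec_def)
  show "bracket A (b g) (b h) = linear_combination A k b (table2 k g h)"
    if "g \<in> labels k" "h \<in> labels k" for g h
    using that assms beyond[of "Suc k"]
    by (cases g; cases h)
       (auto simp: labels_def abelian chain linear_combination_add linear_combination_minus
          linear_combination_diff not_less)
qed

text \<open>
  \<open>L (L + D) = 0\<close> is a product of commuting operators, and \<open>L\<close> and \<open>L + D\<close> cannot both kill \<open>f k\<close>,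
  because their difference \<open>D\<close> fixes it. So one factor is injective and the other one is zero.
\<close>

theorem classification: "isomorphic A (R1 k) \<or> isomorphic A (R2 k)"
proof (cases "bracket A x (f k) = 0")
  case False
  have inj: "u = 0" if "u \<in> N" "bracket A x u = 0" for u
    using commuting_injective[OF endomorphism_left left_right_commute False that] by simp
  have "bracket A x u = - bracket A u x" if "u \<in> N" for u
  proof -
    have "bracket A x (bracket A x u + bracket A u x) = 0"
      using that left_left left_right_commute by (simp add: bracket_add_right)
    then show ?thesis using inj[of "bracket A x u + bracket A u x"] that
      by (simp add: eq_neg_iff_add_eq_0)
  qed
  moreover have "bracket A x x = 0"
    using inj square_in_N left_square by blast
  ultimately show ?thesis using isomorphic_R2_if by blast
next
  case True
  let ?M = "\<lambda>u. bracket A x u + bracket A u x"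
  have M: "endomorphism_on N ?M"
    by (simp add: endomorphism_on_def bracket_add_left bracket_add_right bracket_scale_left
        bracket_scale_right scale_right_distrib)
  have comm: "?M (bracket A u x) = bracket A (?M u) x" if "u \<in> N" for u
    using that by (simp add: bracket_add_left left_right_commute)
  have socle: "?M (f k) \<noteq> 0"
    using True k_pos f_k_nonzero chain[of k] beyond[of "Suc k"] by simp
  have left: "bracket A x u = 0" if "u \<in> N" for u
    using commuting_injective[OF M comm socle, of "bracket A x u"] that left_left by simp
  obtain m where m: "m \<in> N" "bracket A m x = bracket A x x"
    using right_surjective square_in_N by blast
  \<comment> \<open>\<open>[x - m, x - m] = [x, x] - [m, x] = 0\<close> since \<open>L m = 0\<close>; the factor \<open>1\<close> only matches the form of a
    general change of generator.\<close>
  let ?y = "scale A 1 x + (- m)"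
  interpret y: abelian_extension A N ?y
    by (rule change_generator) (use m in simp_all)
  have right: "bracket A u ?y = bracket A u x" if "u \<in> N" for u
    using that m by (simp add: bracket_add_right bracket_minus_right abelian del: add_uminus_conv_diff)
  interpret y: jordan_extension A N ?y k f
    using k_pos dim_A span_f chain beyond by unfold_locales (simp_all only: right f_N)
  show ?thesis
  proof (intro disjI1 y.isomorphic_R1_if)
    show "bracket A ?y u = 0" if "u \<in> N" for u
      using that m left by (simp add: bracket_add_left bracket_minus_left abelian del: add_uminus_conv_diff)
    show "bracket A ?y ?y = 0"
      using m left
      by (simp add: bracket_add_left bracket_minus_left bracket_add_right bracket_minus_right abelian
          del: add_uminus_conv_diff)
  qed
qed

end

section \<open>The two models and the classification\<close>

text \<open>
  The table of \<open>R2\<close> is antisymmetric, so all squares vanish there, whereas the square of \<open>f\<^sub>k + x\<close> in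
  \<open>R1\<close> is \<open>f\<^sub>k\<close>.
\<close>

lemma R1_R2_not_isomorphic:
  assumes k: "1 \<le> k"
  shows "\<not> isomorphic (R1 k) (R2 k)"
proof
  assume "isomorphic (R1 k) (R2 k)"
  then obtain \<phi> where bij: "bij_betw \<phi> (vectors (R1 k)) (vectors (R2 k))"
    and scale: "\<And>c u. u \<in> vectors (R1 k) \<Longrightarrow> \<phi> (scale (R1 k) c u) = scale (R2 k) c (\<phi> u)"
    and bracket: "\<And>u v. \<lbrakk>u \<in> vectors (R1 k); v \<in> vectors (R1 k)\<rbrakk>
          \<Longrightarrow> \<phi> (bracket (R1 k) u v) = bracket (R2 k) (\<phi> u) (\<phi> v)"
    unfolding isomorphic_def by blast
  define w where "w = basis_vec (F k) + basis_vec X"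
  have labels: "F k \<in> labels k" "X \<in> labels k" using k by (auto simp: labels_def)
  have zero_in: "0 \<in> vectors (R1 k)" by (simp add: R1_def table_algebra_def)
  have w_in: "w \<in> vectors (R1 k)"
    using labels by (auto simp: R1_def table_algebra_def w_def basis_vec_def)
  have fk_in: "basis_vec (F k) \<in> vectors (R1 k)"
    using labels by (auto simp: R1_def table_algebra_def basis_vec_def)
  have square_w: "bracket (R1 k) w w = basis_vec (F k)"
  proof
    fix m
    have "bracket (R1 k) w w m =
        (\<Sum>g\<in>labels k. \<Sum>h\<in>labels k. if h = X then if g = F k then basis_vec (F k) m else 0 else 0)"
      unfolding R1_def table_algebra_def complex_algebra.simps
      by (intro sum.cong refl, rename_tac g h, case_tac g; case_tac h) (auto simp: w_def basis_vec_def)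
    also have "\<dots> = basis_vec (F k) m" using labels by simp
    finally show "bracket (R1 k) w w m = basis_vec (F k) m" .
  qed
  have square_zero: "bracket (R2 k) v v = 0" for v
  proof
    fix m
    have anti: "table2 k g h m = - table2 k h g m" for g h
      by (cases g; cases h) simp_all
    let ?s = "\<Sum>g\<in>labels k. \<Sum>h\<in>labels k. v g * v h * table2 k g h m"
    have "?s = (\<Sum>h\<in>labels k. \<Sum>g\<in>labels k. v g * v h * table2 k g h m)"
      by (rule sum.swap)
    also have "\<dots> = - ?s"
      unfolding sum_negf[symmetric]
      by (intro sum.cong refl) (subst anti, simp)
    finally have "?s = 0" by simp
    then show "bracket (R2 k) v v m = 0 m"
      by (simp add: R2_def table_algebra_def)
  qed
  have "\<phi> (basis_vec (F k)) = 0"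
    using bracket[OF w_in w_in] by (simp add: square_w square_zero)
  also have "\<dots> = \<phi> 0"
    using scale[OF zero_in, of 0] by (simp add: R1_def R2_def table_algebra_def zero_fun_def)
  finally have "basis_vec (F k) = 0"
    using bij fk_in zero_in by (auto simp: bij_betw_def dest: inj_onD)
  then have "basis_vec (F k) (F k) = 0" by simp
  then show False by (simp add: basis_vec_def)
qed

theorem theorem3p1:
  fixes R :: "'a::ab_group_add complex_algebra"
    and N :: "'a set" and x :: 'a and k :: nat
  assumes "k \<ge> 1"
    and "leibniz_algebra R"
    and "\<not> nilpotent R"
    and "solvable R"
    and "dimension R = k + 1"
    and "is_nilradical R N"
    and "abelian (subalg R N)"
    and "dimension (subalg R N) = k"
    and "spans_complement R N x"
    and "\<exists>e lam. family_basis (subalg R N) k e \<and>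
           represented_by (subalg R N) k e (\<lambda>y. bracket R y x) (jordan_block k lam)"
  shows "(isomorphic R (R1 k) \<or> isomorphic R (R2 k)) \<and> \<not> isomorphic (R1 k) (R2 k)"
proof -
  interpret leibniz_algebra R by fact
  obtain e lam where e: "family_basis (subalg R N) k e"
    and rep: "represented_by (subalg R N) k e (\<lambda>y. bracket R y x) (jordan_block k lam)"
    using assms(10) by blast
  have ideal: "ideal_of R N" using assms(6) by (simp add: is_nilradical_def)
  have xv: "x \<in> vectors R" and dec: "vectors R = {u + v | u v. u \<in> N \<and> v \<in> span {x}}"
    using assms(9) by (auto simp: spans_complement_def)
  interpret abelian_extension R N x
  proof
    show "x \<notin> N"
    proof
      assume "x \<in> N"
      then have "span {x} \<subseteq> N" using ideal by (intro span_minimal) (auto simp: ideal_of_def)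
      then have "vectors R = N"
        using dec ideal unfolding ideal_of_def by (auto intro: subspace_add)
      then show False using assms(5,8) by (simp add: dimension_def subalg_def)
    qed
    fix u assume "u \<in> vectors R"
    then show "\<exists>n\<in>N. \<exists>c. u = n + scale R c x"
      using dec by (auto simp: span_singleton)
  qed (use ideal xv assms(7) in \<open>auto simp: abelian_def subalg_def\<close>)
  have span_e: "span (e ` {..<k}) = N"
    using e by (simp add: family_basis_def subalg_def)
  have e_N [simp]: "j < k \<Longrightarrow> e j \<in> N" for j
    using span_e span_base[of "e j" "e ` {..<k}"] by simp
  \<comment> \<open>Column \<open>j\<close> of the Jordan block has its off-diagonal one in row \<open>j - 1\<close>.\<close>
  have act: "bracket R (e j) x = scale R lam (e j) + (if j = 0 then 0 else e (j - 1))"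
    if j: "j < k" for j
  proof -
    have "bracket R (e j) x = (\<Sum>i<k. scale R (jordan_block k lam $$ (i, j)) (e i))"
      using rep j by (simp add: represented_by_def subalg_def)
    also have "\<dots> = (\<Sum>i<k. (if i = j then scale R lam (e j) else 0) +
        (if i = j - 1 then if j = 0 then 0 else e (j - 1) else 0))"
      using j by (intro sum.cong) auto
    also have "\<dots> = scale R lam (e j) + (if j = 0 then 0 else e (j - 1))"
      using j less_imp_diff_less[OF j, of 1] by (simp add: sum.distrib)
    finally show ?thesis .
  qed
  have lam: "lam \<noteq> 0"
  proof
    assume lam: "lam = 0"
    let ?D = "\<lambda>u. bracket R u x"
    have pow: "(?D ^^ n) (e j) = (if j < n then 0 else e (j - n))" if "j < k" for n j
      using that by (induction n) (auto simp: act lam not_less)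
    have "(?D ^^ k) u = 0" if uN: "u \<in> N" for u
    proof -
      obtain a where u: "u = (\<Sum>v\<in>e ` {..<k}. scale R (a v) v)"
        using uN span_e span_finite[of "e ` {..<k}"] by auto
      have "(?D ^^ k) u = (\<Sum>v\<in>e ` {..<k}. scale R (a v) ((?D ^^ k) v))"
        unfolding u
        by (rule endomorphism_on_sum[OF subspace_N endomorphism_on_funpow[OF endomorphism_right]])
           auto
      also have "\<dots> = 0" by (intro sum.neutral) (auto simp: pow)
      finally show ?thesis .
    qed
    then show False using nilpotent_if_right_nilpotent assms(3) by blast
  qed
  let ?y = "scale R (1 / lam) x + 0"
  \<comment> \<open>The block sends \<open>e j\<close> towards \<open>e 0\<close>, while the chain \<open>f\<close> ascends, hence the reversal. Dividing \<open>x\<close>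
    by \<open>lam\<close> turns the off-diagonal entries into \<open>1 / lam\<close>, which the powers absorb.\<close>
  define f where "f i = (if i \<le> k then scale R ((1 / lam) ^ (i - 1)) (e (k - i)) else 0)" for i
  interpret y: abelian_extension R N ?y
    by (rule change_generator) (use lam in simp_all)
  interpret y: jordan_extension R N ?y k f
  proof
    have f_N: "f i \<in> N" if "1 \<le> i" for i using that by (simp add: f_def)
    show "span (f ` {1..k}) = N"
    proof
      show "span (f ` {1..k}) \<subseteq> N" by (intro span_minimal subspace_N) (auto simp: f_N)
      have "e j \<in> span (f ` {1..k})" if "j < k" for j
      proof -
        have "e j = scale R (lam ^ (k - j - 1)) (f (k - j))"
          using that lam by (simp add: f_def power_one_over)
        moreover have "f (k - j) \<in> f ` {1..k}" using that by auto
        ultimately show ?thesis using span_base span_scale by metis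
      qed
      then show "N \<subseteq> span (f ` {1..k})"
        unfolding span_e[symmetric] by (intro span_minimal) auto
    qed
    show "bracket R (f i) ?y = f i + f (Suc i)" if i: "1 \<le> i" for i
    proof (cases "i \<le> k")
      case True
      have "bracket R (f i) ?y = scale R ((1 / lam) ^ (i - 1) * (1 / lam)) (bracket R (e (k - i)) x)"
        using True i by (simp add: f_def bracket_scale_left bracket_scale_right mult.commute)
      also have "\<dots> = scale R ((1 / lam) ^ (i - 1)) (e (k - i)) +
          (if i = k then 0 else scale R ((1 / lam) ^ i) (e (k - Suc i)))"
        using True i lam by (cases i) (auto simp: act scale_right_distrib)
      also have "\<dots> = f i + f (Suc i)"
        using True i by (auto simp: f_def)
      finally show ?thesis .
    qed (simp add: f_def)
  qed (use assms(1,5) in \<open>auto simp: f_def\<close>)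
  show ?thesis
    using y.classification R1_R2_not_isomorphic[OF assms(1)] by blast
qed

end
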